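(* Let $X$ and $Y$ be metric spaces with $d^c_{GH}(X,Y)<\infty$, let $\varepsilon>0$, and let $f\colon X\to Y$, $g\colon Y\to X$ be continuous maps such that $R=R_{f,g}$ satisfies $\operatorname{dis} R<2d^c_{GH}(X,Y)+2\varepsilon$. For $t\in(0,1)$ let $R_t$ be the set $R$ with the metric $$d_t\bigl((x,y),(x',y')\bigr)=(1-t)|xx'|+t\,|yy'|,$$ and put $R_0=X$, $R_1=Y$. Then $d^c_{GH}(R_t,R_s)\le |t-s|\,\operatorname{dis} R$ for all $t,s\in[0,1]$. In particular, the mapping $\gamma\colon t\mapsto R_t$, $t\in[0,1]$, is a curve, continuous with respect to $d^c_{GH}$, whose length $|\gamma|$ satisfies $|\gamma|<d^c_{GH}(X,Y)+\varepsilon$, and the continuous Gromov--Hausdorff distance is intrinsic.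
   Context: All metric spaces are non-empty; $|xx'|$ denotes the distance between points $x,x'$. For a non-empty relation $\sigma\subset X\times Y$, $\operatorname{dis}\sigma=\sup\{||xx'|-|yy'||:(x,y),(x',y')\in\sigma\}$. For maps $f\colon X\to Y$ and $g\colon Y\to X$, $R_{f,g}=\{(x,f(x)):x\in X\}\cup\{(g(y),y):y\in Y\}\subset X\times Y$. The continuous Gromov--Hausdorff distance is $$d^c_{GH}(X,Y)=\frac12\inf\{\operatorname{dis} R_{f,g}: f\colon X\to Y,\ g\colon Y\to X \text{ continuous}\}\in[0,\infty].$$ The length of a curve is the supremum over partitions of the sums of consecutive $d^c_{GH}$-distances. A generalized pseudometric is intrinsic if the distance between any two points at finite distance equals the infimum of the lengths of continuous curves joining them. (Since all metric spaces, up to isometry, form a proper class, the curve is understood as a map from $[0,1]$ to this class, continuous with respect to $d^c_{GH}$.) *)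

theory Defs
  imports "HOL-Analysis.Analysis" "HOL-Library.Infinite_Typeclass"
begin

definition distortion :: "'a metric \<Rightarrow> 'b metric \<Rightarrow> ('a \<times> 'b) set \<Rightarrow> ennreal" where
  "distortion X Y \<sigma> =
     (SUP ((x, y), (x', y')) \<in> \<sigma> \<times> \<sigma>. ennreal \<bar>mdist X x x' - mdist Y y y'\<bar>)"

definition corr :: "'a metric \<Rightarrow> 'b metric \<Rightarrow> ('a \<Rightarrow> 'b) \<Rightarrow> ('b \<Rightarrow> 'a) \<Rightarrow> ('a \<times> 'b) set" where
  "corr X Y f g = {(x, f x) |x. x \<in> mspace X} \<union> {(g y, y) |y. y \<in> mspace Y}"

definition dGHc :: "'a metric \<Rightarrow> 'b metric \<Rightarrow> ennreal" where
  "dGHc X Y =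
     (INF (f, g) \<in> {(f, g). continuous_map (mtopology_of X) (mtopology_of Y) f \<and>
                         continuous_map (mtopology_of Y) (mtopology_of X) g}.
        distortion X Y (corr X Y f g)) / 2"

text \<open>Generalized pseudometrics (distance \<open>\<infinity>\<close> between points and distance 0 between distinct
  points are allowed), on a collection \<open>M\<close> of points.\<close>

definition gen_pseudometric_on :: "'m set \<Rightarrow> ('m \<Rightarrow> 'm \<Rightarrow> ennreal) \<Rightarrow> bool" where
  "gen_pseudometric_on M d \<longleftrightarrow>
     (\<forall>x\<in>M. d x x = 0) \<and>
     (\<forall>x\<in>M. \<forall>y\<in>M. d x y = d y x) \<and>
     (\<forall>x\<in>M. \<forall>y\<in>M. \<forall>z\<in>M. d x z \<le> d x y + d y z)"

definition curve_in :: "'m set \<Rightarrow> ('m \<Rightarrow> 'm \<Rightarrow> ennreal) \<Rightarrow> (real \<Rightarrow> 'm) \<Rightarrow> bool" where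
  "curve_in M d \<gamma> \<longleftrightarrow>
     (\<forall>t\<in>{0..1}. \<gamma> t \<in> M) \<and>
     (\<forall>t\<in>{0..1}. ((\<lambda>s. d (\<gamma> t) (\<gamma> s)) \<longlongrightarrow> 0) (at t within {0..1}))"

definition curve_length :: "('m \<Rightarrow> 'm \<Rightarrow> ennreal) \<Rightarrow> (real \<Rightarrow> 'm) \<Rightarrow> ennreal" where
  "curve_length d \<gamma> =
     (SUP (n, \<tau>) \<in> {(n::nat, \<tau>::nat \<Rightarrow> real). \<tau> 0 = 0 \<and> \<tau> n = 1 \<and> (\<forall>i<n. \<tau> i < \<tau> (Suc i))}.
        \<Sum>i<n. d (\<gamma> (\<tau> i)) (\<gamma> (\<tau> (Suc i))))"

definition intrinsic_on :: "'m set \<Rightarrow> ('m \<Rightarrow> 'm \<Rightarrow> ennreal) \<Rightarrow> bool" where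
  "intrinsic_on M d \<longleftrightarrow>
     gen_pseudometric_on M d \<and>
     (\<forall>x\<in>M. \<forall>y\<in>M. d x y < \<infinity> \<longrightarrow>
        d x y = (INF \<gamma> \<in> {\<gamma>. curve_in M d \<gamma> \<and> \<gamma> 0 = x \<and> \<gamma> 1 = y}. curve_length d \<gamma>))"

text \<open>The class of all metric spaces is rendered by the collections of non-empty metric spaces with
  carrier in a type \<open>'u\<close>, for all infinite types \<open>'u\<close>: every set-indexed family of metric
  spaces, in particular every curve, is up to isometry contained in one of these collections.\<close>

definition metric_spaces :: "'u metric set" where
  "metric_spaces = {Z. mspace Z \<noteq> {}}"

definition interp_space ::
  "'a metric \<Rightarrow> 'b metric \<Rightarrow> ('a \<times> 'b) set \<Rightarrow> real \<Rightarrow> ('a \<times> 'b) metric" where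
  "interp_space X Y R t =
     metric (R, \<lambda>(x, y) (x', y'). (1 - t) * mdist X x x' + t * mdist Y y y')"

text \<open>The function \<open>metric\<close> is only meaningful on actual metric spaces; the following lemmas show
  that this is the case here.\<close>

lemma Metric_space_interp_space:
  assumes "R \<subseteq> mspace X \<times> mspace Y" "0 < t" "t < 1"
  shows "Metric_space R (\<lambda>(x, y) (x', y'). (1 - t) * mdist X x x' + t * mdist Y y y')"
proof
  show "0 \<le> (case p of (x, y) \<Rightarrow> \<lambda>(x', y'). (1 - t) * mdist X x x' + t * mdist Y y y') q" for p q
    using assms by (auto split: prod.splits)
  show "(case p of (x, y) \<Rightarrow> \<lambda>(x', y'). (1 - t) * mdist X x x' + t * mdist Y y y') q =
        (case q of (x, y) \<Rightarrow> \<lambda>(x', y'). (1 - t) * mdist X x x' + t * mdist Y y y') p" for p q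
    by (auto simp: mdist_commute split: prod.splits)
  show "(case p of (x, y) \<Rightarrow> \<lambda>(x', y'). (1 - t) * mdist X x x' + t * mdist Y y y') q = 0 \<longleftrightarrow> p = q"
    if "p \<in> R" "q \<in> R" for p q
  proof -
    obtain x y x' y' where "p = (x, y)" "q = (x', y')" by fastforce
    with that assms have "x \<in> mspace X" "x' \<in> mspace X" "y \<in> mspace Y" "y' \<in> mspace Y" by auto
    with \<open>p = _\<close> \<open>q = _\<close> assms show ?thesis
      by (simp add: add_nonneg_eq_0_iff)
  qed
  show "(case p of (x, y) \<Rightarrow> \<lambda>(x', y'). (1 - t) * mdist X x x' + t * mdist Y y y') r \<le>
        (case p of (x, y) \<Rightarrow> \<lambda>(x', y'). (1 - t) * mdist X x x' + t * mdist Y y y') q +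
        (case q of (x, y) \<Rightarrow> \<lambda>(x', y'). (1 - t) * mdist X x x' + t * mdist Y y y') r"
    if "p \<in> R" "q \<in> R" "r \<in> R" for p q r
  proof -
    obtain x y x' y' x'' y'' where e: "p = (x, y)" "q = (x', y')" "r = (x'', y'')"
      by (metis surj_pair)
    with that assms
    have "mdist X x x'' \<le> mdist X x x' + mdist X x' x''" "mdist Y y y'' \<le> mdist Y y y' + mdist Y y' y''"
      by (auto intro!: mdist_triangle)
    then have "(1 - t) * mdist X x x'' \<le> (1 - t) * (mdist X x x' + mdist X x' x'')"
        "t * mdist Y y y'' \<le> t * (mdist Y y y' + mdist Y y' y'')"
      using assms by (auto intro: mult_left_mono)
    with e show ?thesis by (simp add: algebra_simps)
  qed
qed

lemma interp_space_simps:
  assumes "R \<subseteq> mspace X \<times> mspace Y" "0 < t" "t < 1"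
  shows "mspace (interp_space X Y R t) = R"
    and "mdist (interp_space X Y R t) (x, y) (x', y') = (1 - t) * mdist X x x' + t * mdist Y y y'"
  unfolding interp_space_def
  by (simp_all add: Metric_space.mspace_metric[OF Metric_space_interp_space[OF assms]]
        Metric_space.mdist_metric[OF Metric_space_interp_space[OF assms]])

definition isometric_copy :: "('a \<Rightarrow> 'c) \<Rightarrow> 'a metric \<Rightarrow> 'c metric" where
  "isometric_copy e X =
     metric (e ` mspace X, \<lambda>u v. mdist X (inv_into (mspace X) e u) (inv_into (mspace X) e v))"

lemma isometric_copy_simps:
  assumes "inj_on e (mspace X)"
  shows "mspace (isometric_copy e X) = e ` mspace X"
    and "x \<in> mspace X \<Longrightarrow> x' \<in> mspace X \<Longrightarrow> mdist (isometric_copy e X) (e x) (e x') = mdist X x x'"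
proof -
  interpret M: Metric_space "e ` mspace X"
    "\<lambda>u v. mdist X (inv_into (mspace X) e u) (inv_into (mspace X) e v)"
  proof
    fix u v w
    show "0 \<le> mdist X (inv_into (mspace X) e u) (inv_into (mspace X) e v)" by (rule mdist_nonneg)
    show "mdist X (inv_into (mspace X) e u) (inv_into (mspace X) e v) =
          mdist X (inv_into (mspace X) e v) (inv_into (mspace X) e u)" by (rule mdist_commute)
    assume uv: "u \<in> e ` mspace X" "v \<in> e ` mspace X"
    then show "mdist X (inv_into (mspace X) e u) (inv_into (mspace X) e v) = 0 \<longleftrightarrow> u = v"
      by (metis inv_into_into inv_into_injective mdist_zero)
    assume "w \<in> e ` mspace X"
    with uv show "mdist X (inv_into (mspace X) e u) (inv_into (mspace X) e w) \<le>
          mdist X (inv_into (mspace X) e u) (inv_into (mspace X) e v) +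
          mdist X (inv_into (mspace X) e v) (inv_into (mspace X) e w)"
      by (metis inv_into_into mdist_triangle)
  qed
  show "mspace (isometric_copy e X) = e ` mspace X"
    by (simp add: isometric_copy_def)
  show "mdist (isometric_copy e X) (e x) (e x') = mdist X x x'" if "x \<in> mspace X" "x' \<in> mspace X"
    using assms that by (simp add: isometric_copy_def)
qed

text \<open>The curve \<open>t \<mapsto> R\<^sub>t\<close>, where \<open>R\<^sub>0 = X\<close> and \<open>R\<^sub>1 = Y\<close>. As \<open>X\<close>, \<open>Y\<close> and \<open>R\<close> live in different types,
  each of these spaces is replaced by its isometric copy in the disjoint sum of the three types.\<close>

definition interp_curve ::
  "'a metric \<Rightarrow> 'b metric \<Rightarrow> ('a \<times> 'b) set \<Rightarrow> real \<Rightarrow> ('a + 'b + 'a \<times> 'b) metric" where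
  "interp_curve X Y R t =
     (if t = 0 then isometric_copy Inl X
      else if t = 1 then isometric_copy (Inr \<circ> Inl) Y
      else isometric_copy (Inr \<circ> Inr) (interp_space X Y R t))"

end

theory Submission
  imports Defs
begin

text \<open>Every \<open>R\<^sub>t\<close>, including \<open>R\<^sub>0 = X\<close> and \<open>R\<^sub>1 = Y\<close>, is parametrised by \<open>R\<close>: by the identity for
  \<open>0 < t < 1\<close> and by the two projections at the ends. In this parametrisation \<open>d\<^sub>t - d\<^sub>s\<close> equals
  \<open>(s - t) (|xx'| - |yy'|)\<close>, and the maps \<open>x \<mapsto> (x, f x)\<close>, \<open>y \<mapsto> (g y, y)\<close>, the projections and the
  identity are continuous, so that \<open>R\<^sub>t\<close> and \<open>R\<^sub>s\<close> are at distance at most \<open>|t - s| dis R / 2\<close>. The factor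
  \<open>1/2\<close> is what the bound on the length needs. For intrinsicness inside an infinite type, the
  \<open>R\<^sub>t\<close> are moved into it along an injection \<open>'u \<times> 'u \<Rightarrow> 'u\<close>; this changes no distance, as isometric
  copies are at distance 0 and the triangle inequality holds.\<close>

section \<open>Metric criteria for continuity\<close>

lemma continuous_map_mtopology_of_iff:
  "continuous_map (mtopology_of A) (mtopology_of B) h \<longleftrightarrow>
     h ` mspace A \<subseteq> mspace B \<and>
     (\<forall>a\<in>mspace A. \<forall>\<epsilon>>0. \<exists>\<delta>>0. \<forall>x. x \<in> mspace A \<and> mdist A a x < \<delta> \<longrightarrow> mdist B (h a) (h x) < \<epsilon>)"
  unfolding mtopology_of_def
  by (rule Metric_space.metric_continuous_map) auto

lemma continuous_map_mtopology_of_in: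
  assumes "continuous_map (mtopology_of A) (mtopology_of B) h" "a \<in> mspace A"
  shows "h a \<in> mspace B"
  using assms by (auto simp: continuous_map_mtopology_of_iff)

lemma continuous_map_Lipschitz:
  assumes "\<And>a. a \<in> mspace A \<Longrightarrow> h a \<in> mspace B"
    and "\<And>a a'. a \<in> mspace A \<Longrightarrow> a' \<in> mspace A \<Longrightarrow> mdist B (h a) (h a') \<le> C * mdist A a a'"
  shows "continuous_map (mtopology_of A) (mtopology_of B) h"
proof -
  have "Lipschitz_continuous_map A B h"
    unfolding Lipschitz_continuous_map_def using assms by blast
  then show ?thesis
    by (rule Lipschitz_continuous_imp_continuous_map)
qed

subsection \<open>The continuous Gromov--Hausdorff distance\<close>

lemma distortion_leI:
  assumes "\<And>x y x' y'. (x, y) \<in> \<sigma> \<Longrightarrow> (x', y') \<in> \<sigma> \<Longrightarrow> ennreal \<bar>mdist X x x' - mdist Y y y'\<bar> \<le> c"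
  shows "distortion X Y \<sigma> \<le> c"
  unfolding distortion_def using assms by (auto intro!: SUP_least)

lemma distortion_ge:
  assumes "(x, y) \<in> \<sigma>" "(x', y') \<in> \<sigma>"
  shows "ennreal \<bar>mdist X x x' - mdist Y y y'\<bar> \<le> distortion X Y \<sigma>"
  unfolding distortion_def
  by (rule SUP_upper2[of "((x, y), (x', y'))"]) (use assms in auto)

lemma distortion_converse: "distortion Y X (\<sigma>\<inverse>) \<le> distortion X Y \<sigma>"
proof (rule distortion_leI)
  fix y x y' x' assume "(y, x) \<in> \<sigma>\<inverse>" "(y', x') \<in> \<sigma>\<inverse>"
  then show "ennreal \<bar>mdist Y y y' - mdist X x x'\<bar> \<le> distortion X Y \<sigma>"
    using distortion_ge[of x y \<sigma> x' y' X Y] by (simp add: abs_minus_commute)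
qed

text \<open>Two pairs of the composite factor through points \<open>y\<close>, \<open>y'\<close>,
  and inserting \<open>mdist Y y y'\<close> splits the difference in two. This is the metric core of
  the triangle inequality for \<open>dGHc\<close>.\<close>

lemma distortion_relcomp:
  "distortion X Z (\<sigma> O \<rho>) \<le> distortion X Y \<sigma> + distortion Y Z \<rho>"
proof (rule distortion_leI)
  fix x z x' z' assume "(x, z) \<in> \<sigma> O \<rho>" "(x', z') \<in> \<sigma> O \<rho>"
  then obtain y y' where y: "(x, y) \<in> \<sigma>" "(y, z) \<in> \<rho>" "(x', y') \<in> \<sigma>" "(y', z') \<in> \<rho>"
    by blast
  have "ennreal \<bar>mdist X x x' - mdist Z z z'\<bar>
      \<le> ennreal (\<bar>mdist X x x' - mdist Y y y'\<bar> + \<bar>mdist Y y y' - mdist Z z z'\<bar>)"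
    by (rule ennreal_leI) linarith
  also have "\<dots> = ennreal \<bar>mdist X x x' - mdist Y y y'\<bar> + ennreal \<bar>mdist Y y y' - mdist Z z z'\<bar>"
    by (simp add: ennreal_plus)
  also have "\<dots> \<le> distortion X Y \<sigma> + distortion Y Z \<rho>"
    by (intro add_mono distortion_ge y)
  finally show "ennreal \<bar>mdist X x x' - mdist Z z z'\<bar> \<le> distortion X Y \<sigma> + distortion Y Z \<rho>" .
qed

lemma distortion_mono: "\<sigma> \<subseteq> \<rho> \<Longrightarrow> distortion X Y \<sigma> \<le> distortion X Y \<rho>"
  by (auto intro!: distortion_leI distortion_ge)

lemma corr_converse: "corr Y X g f = (corr X Y f g)\<inverse>"
  by (auto simp: corr_def)

lemma corr_subset:
  assumes "continuous_map (mtopology_of X) (mtopology_of Y) f"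
    and "continuous_map (mtopology_of Y) (mtopology_of X) g"
  shows "corr X Y f g \<subseteq> mspace X \<times> mspace Y"
  using assms by (auto simp: corr_def dest: continuous_map_mtopology_of_in)

lemma dGHc_le:
  assumes "continuous_map (mtopology_of X) (mtopology_of Y) f"
    and "continuous_map (mtopology_of Y) (mtopology_of X) g"
    and "distortion X Y (corr X Y f g) \<le> c"
  shows "dGHc X Y \<le> c / 2"
  unfolding dGHc_def
  by (intro divide_right_mono_ennreal INF_lower2[of "(f, g)"]) (use assms in auto)

text \<open>The division by 2 stands outside the infimum in \<open>dGHc\<close>. Doubling both sides
  moves it inside, since halving and doubling are mutually inverse on all of \<open>ennreal\<close>,
  infinity included.\<close>

lemma dGHc_greatest:
  assumes "\<And>f g. continuous_map (mtopology_of X) (mtopology_of Y) f \<Longrightarrow>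
      continuous_map (mtopology_of Y) (mtopology_of X) g \<Longrightarrow>
      c \<le> distortion X Y (corr X Y f g) / 2"
  shows "c \<le> dGHc X Y"
proof -
  have half: "a = 2 * (a / 2)" for a :: ennreal
    by (simp add: ennreal_times_divide mult_divide_eq_ennreal mult.commute)
  have "2 * c \<le> (INF (f, g) \<in> {(f, g). continuous_map (mtopology_of X) (mtopology_of Y) f \<and>
                         continuous_map (mtopology_of Y) (mtopology_of X) g}.
        distortion X Y (corr X Y f g))" (is "_ \<le> ?I")
  proof (rule INF_greatest, clarify)
    fix f g assume "continuous_map (mtopology_of X) (mtopology_of Y) f"
      "continuous_map (mtopology_of Y) (mtopology_of X) g"
    then have "2 * c \<le> 2 * (distortion X Y (corr X Y f g) / 2)"
      by (intro mult_left_mono assms) auto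
    then show "2 * c \<le> distortion X Y (corr X Y f g)"
      by (simp flip: half)
  qed
  then have "2 * c / 2 \<le> ?I / 2"
    by (rule divide_right_mono_ennreal)
  then show ?thesis
    by (simp add: dGHc_def mult_divide_eq_ennreal mult.commute[of 2])
qed

lemma dGHc_lessE:
  assumes "dGHc X Y < c"
  obtains f g where "continuous_map (mtopology_of X) (mtopology_of Y) f"
    "continuous_map (mtopology_of Y) (mtopology_of X) g"
    "distortion X Y (corr X Y f g) / 2 < c"
  using dGHc_greatest[of X Y c] assms by (meson leD leI)

section \<open>Pseudometric axioms and invariance under isometry\<close>

lemma dGHc_refl [simp]: "dGHc X X = 0"
proof -
  have "dGHc X X \<le> 0 / 2"
  proof (rule dGHc_le)
    show "distortion X X (corr X X (\<lambda>x. x) (\<lambda>x. x)) \<le> 0"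
      by (rule distortion_leI) (auto simp: corr_def)
  qed auto
  then show ?thesis by simp
qed

lemma dGHc_commute_le: "dGHc Y X \<le> dGHc X Y"
  by (rule dGHc_greatest, rule dGHc_le) (auto simp: corr_converse[of Y X] distortion_converse)

lemma dGHc_commute: "dGHc X Y = dGHc Y X"
  by (intro antisym dGHc_commute_le)

text \<open>Nearly optimal pairs of maps for \<open>X\<close>, \<open>Y\<close> and for
  \<open>Y\<close>, \<open>Z\<close> are composed in both directions.\<close>

lemma dGHc_triangle: "dGHc X Z \<le> dGHc X Y + dGHc Y Z"
proof (rule ennreal_le_epsilon)
  fix e :: real assume fin: "dGHc X Y + dGHc Y Z < top" and e: "0 < e"
  \<comment> \<open>Finiteness of both distances makes the added \<open>e/2\<close> a strict
    increase.\<close>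
  have "dGHc X Y < dGHc X Y + ennreal (e/2)" "dGHc Y Z < dGHc Y Z + ennreal (e/2)"
    using fin e by (auto simp: ennreal_add_left_cancel_less)
  then obtain f g h k where
    fg: "continuous_map (mtopology_of X) (mtopology_of Y) f"
      "continuous_map (mtopology_of Y) (mtopology_of X) g"
      "distortion X Y (corr X Y f g) / 2 < dGHc X Y + ennreal (e/2)"
    and hk: "continuous_map (mtopology_of Y) (mtopology_of Z) h"
      "continuous_map (mtopology_of Z) (mtopology_of Y) k"
      "distortion Y Z (corr Y Z h k) / 2 < dGHc Y Z + ennreal (e/2)"
    by (meson dGHc_lessE)
  \<comment> \<open>The pair \<open>(x, h (f x))\<close> passes through \<open>f x\<close>, and
    \<open>(g (k z), z)\<close> passes through \<open>k z\<close>.\<close>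
  have "corr X Z (h \<circ> f) (g \<circ> k) \<subseteq> corr X Y f g O corr Y Z h k"
    using fg hk by (fastforce simp: corr_def dest: continuous_map_mtopology_of_in)
  then have "dGHc X Z \<le> (distortion X Y (corr X Y f g) + distortion Y Z (corr Y Z h k)) / 2"
    by (intro dGHc_le[of _ _ "h \<circ> f" "g \<circ> k"] continuous_map_compose[OF fg(1) hk(1)]
        continuous_map_compose[OF hk(2) fg(2)] order.trans[OF distortion_mono distortion_relcomp])
  also have "\<dots> \<le> (dGHc X Y + ennreal (e/2)) + (dGHc Y Z + ennreal (e/2))"
    unfolding add_divide_distrib_ennreal using fg(3) hk(3) by (intro add_mono) auto
  also have "\<dots> = dGHc X Y + dGHc Y Z + (ennreal (e/2) + ennreal (e/2))"
    by (simp add: ac_simps)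
  also have "ennreal (e/2) + ennreal (e/2) = ennreal e"
    using e by (simp flip: ennreal_plus)
  finally show "dGHc X Z \<le> dGHc X Y + dGHc Y Z + ennreal e" .
qed

text \<open>Spaces at distance 0 may replace each other even when their carriers live in different
  types, which permits passing to isometric copies.\<close>

lemma dGHc_cong_le:
  assumes "dGHc A X = 0" "dGHc B Y = 0"
  shows "dGHc A B \<le> dGHc X Y"
proof -
  have "dGHc A B \<le> dGHc A X + (dGHc X Y + dGHc Y B)"
    by (meson add_left_mono dGHc_triangle order.trans)
  then show ?thesis
    using assms by (simp add: dGHc_commute[of Y B])
qed

text \<open>The map \<open>e\<close> and its inverse are isometries, and their correspondence has
  distortion 0.\<close>

lemma dGHc_isometric_copy:
  assumes "inj_on e (mspace X)"
  shows "dGHc (isometric_copy e X) X = 0"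
proof -
  note [simp] = isometric_copy_simps[OF assms]
  have "dGHc X (isometric_copy e X) \<le> 0 / 2"
  proof (rule dGHc_le)
    show "continuous_map (mtopology_of X) (mtopology_of (isometric_copy e X)) e"
      by (rule continuous_map_Lipschitz[where C = 1]) auto
    show "continuous_map (mtopology_of (isometric_copy e X)) (mtopology_of X) (inv_into (mspace X) e)"
      by (rule continuous_map_Lipschitz[where C = 1]) (use assms in auto)
    show "distortion X (isometric_copy e X)
        (corr X (isometric_copy e X) e (inv_into (mspace X) e)) \<le> 0"
      by (rule distortion_leI) (use assms in \<open>auto simp: corr_def\<close>)
  qed
  then show ?thesis by (simp add: dGHc_commute[of X])
qed

subsection \<open>Interpolation\<close>

text \<open>The metric of the target is a convex combination of the two coordinate distances, so it
  is below \<epsilon> once both of these are; continuity can be checked in each coordinate.\<close>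

lemma continuous_map_into_interp_space:
  assumes R: "R \<subseteq> mspace X \<times> mspace Y" and s: "0 < s" "s < 1"
    and h: "\<And>a. a \<in> mspace A \<Longrightarrow> h a \<in> R"
    and fst: "continuous_map (mtopology_of A) (mtopology_of X) (\<lambda>a. fst (h a))"
    and snd: "continuous_map (mtopology_of A) (mtopology_of Y) (\<lambda>a. snd (h a))"
  shows "continuous_map (mtopology_of A) (mtopology_of (interp_space X Y R s)) h"
  unfolding continuous_map_mtopology_of_iff
proof (intro conjI ballI allI impI)
  show "h ` mspace A \<subseteq> mspace (interp_space X Y R s)"
    using h by (auto simp: interp_space_simps[OF R s])
  fix a and \<epsilon> :: real assume a: "a \<in> mspace A" and \<epsilon>: "0 < \<epsilon>"
  obtain \<delta>1 where d1: "\<delta>1 > 0" "\<And>x. x \<in> mspace A \<Longrightarrow> mdist A a x < \<delta>1 \<Longrightarrow>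
      mdist X (fst (h a)) (fst (h x)) < \<epsilon>"
    using fst a \<epsilon> unfolding continuous_map_mtopology_of_iff by meson
  obtain \<delta>2 where d2: "\<delta>2 > 0" "\<And>x. x \<in> mspace A \<Longrightarrow> mdist A a x < \<delta>2 \<Longrightarrow>
      mdist Y (snd (h a)) (snd (h x)) < \<epsilon>"
    using snd a \<epsilon> unfolding continuous_map_mtopology_of_iff by meson
  show "\<exists>\<delta>>0. \<forall>x. x \<in> mspace A \<and> mdist A a x < \<delta> \<longrightarrow>
      mdist (interp_space X Y R s) (h a) (h x) < \<epsilon>"
  proof (intro exI[of _ "min \<delta>1 \<delta>2"] conjI allI impI)
    fix x assume x: "x \<in> mspace A \<and> mdist A a x < min \<delta>1 \<delta>2"
    have "mdist (interp_space X Y R s) (h a) (h x) =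
        (1 - s) * mdist X (fst (h a)) (fst (h x)) + s * mdist Y (snd (h a)) (snd (h x))"
      by (simp flip: interp_space_simps(2)[OF R s])
    also have "\<dots> < (1 - s) * \<epsilon> + s * \<epsilon>"
      using x d1(2)[of x] d2(2)[of x] s by (intro add_strict_mono mult_strict_left_mono) auto
    finally show "mdist (interp_space X Y R s) (h a) (h x) < \<epsilon>"
      by (simp add: algebra_simps)
  qed (use d1 d2 in auto)
qed

text \<open>The first coordinate enters the metric with the positive weight \<open>1 - s\<close>,
  which makes the projection Lipschitz with the reciprocal constant.\<close>

lemma continuous_map_interp_space_fst:
  assumes R: "R \<subseteq> mspace X \<times> mspace Y" and s: "0 < s" "s < 1"
  shows "continuous_map (mtopology_of (interp_space X Y R s)) (mtopology_of X) fst"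
proof (rule continuous_map_Lipschitz[where C = "1 / (1 - s)"])
  fix p q
  have "mdist (interp_space X Y R s) p q = (1 - s) * mdist X (fst p) (fst q) + s * mdist Y (snd p) (snd q)"
    by (simp flip: interp_space_simps(2)[OF R s])
  moreover have "0 \<le> s * mdist Y (snd p) (snd q)"
    using s by simp
  ultimately have "(1 - s) * mdist X (fst p) (fst q) \<le> mdist (interp_space X Y R s) p q"
    by linarith
  then show "mdist X (fst p) (fst q) \<le> 1 / (1 - s) * mdist (interp_space X Y R s) p q"
    using s by (simp add: field_simps)
qed (use R in \<open>auto simp: interp_space_simps[OF R s]\<close>)

lemma continuous_map_interp_space_snd:
  assumes R: "R \<subseteq> mspace X \<times> mspace Y" and s: "0 < s" "s < 1"
  shows "continuous_map (mtopology_of (interp_space X Y R s)) (mtopology_of Y) snd"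
proof (rule continuous_map_Lipschitz[where C = "1 / s"])
  fix p q
  have "mdist (interp_space X Y R s) p q = (1 - s) * mdist X (fst p) (fst q) + s * mdist Y (snd p) (snd q)"
    by (simp flip: interp_space_simps(2)[OF R s])
  moreover have "0 \<le> (1 - s) * mdist X (fst p) (fst q)"
    using s by simp
  ultimately have "s * mdist Y (snd p) (snd q) \<le> mdist (interp_space X Y R s) p q"
    by linarith
  then show "mdist Y (snd p) (snd q) \<le> 1 / s * mdist (interp_space X Y R s) p q"
    using s by (simp add: field_simps)
qed (use R in \<open>auto simp: interp_space_simps[OF R s]\<close>)

text \<open>Common form of the three estimates below: \<open>u\<close> and \<open>v\<close>
  parametrise both sides of \<sigma> by \<open>R\<close>, and in this parametrisation the two
  metrics differ by \<open>c\<close> times the difference measured by the distortion of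
  \<open>R\<close>.\<close>

lemma distortion_le_scaled:
  assumes "0 \<le> c"
    and "\<And>a b. (a, b) \<in> \<sigma> \<Longrightarrow> \<exists>p\<in>R. a = u p \<and> b = v p"
    and "\<And>x y x' y'. (x, y) \<in> R \<Longrightarrow> (x', y') \<in> R \<Longrightarrow>
      \<bar>mdist A (u (x, y)) (u (x', y')) - mdist B (v (x, y)) (v (x', y'))\<bar>
        = c * \<bar>mdist X x x' - mdist Y y y'\<bar>"
  shows "distortion A B \<sigma> \<le> ennreal c * distortion X Y R"
proof (rule distortion_leI)
  fix a b a' b' assume "(a, b) \<in> \<sigma>" "(a', b') \<in> \<sigma>"
  then obtain x y x' y' where p: "(x, y) \<in> R" "a = u (x, y)" "b = v (x, y)"
    "(x', y') \<in> R" "a' = u (x', y')" "b' = v (x', y')"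
    using assms(2) by (metis surj_pair)
  have "ennreal \<bar>mdist A a a' - mdist B b b'\<bar> = ennreal c * ennreal \<bar>mdist X x x' - mdist Y y y'\<bar>"
    using p assms(1,3) by (simp flip: ennreal_mult)
  also have "\<dots> \<le> ennreal c * distortion X Y R"
    using p by (intro mult_left_mono distortion_ge) auto
  finally show "ennreal \<bar>mdist A a a' - mdist B b b'\<bar> \<le> ennreal c * distortion X Y R" .
qed

context
  fixes X :: "'a metric" and Y :: "'b metric" and f g R
  assumes f: "continuous_map (mtopology_of X) (mtopology_of Y) f"
    and g: "continuous_map (mtopology_of Y) (mtopology_of X) g"
  defines "R \<equiv> corr X Y f g"
begin

text \<open>The graph map of \<open>f\<close> and the first projection are the two continuous maps.
  Their correspondence consists of pairs \<open>(fst p, p)\<close> with \<open>p\<close> in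
  \<open>R\<close>, and the metrics differ by \<open>s\<close> times the original
  difference.\<close>

lemma dGHc_left_interp_space:
  assumes s: "0 < s" "s < 1"
  shows "dGHc X (interp_space X Y R s) \<le> ennreal s * distortion X Y R / 2"
proof -
  note R = corr_subset[OF f g, folded R_def]
  let ?S = "interp_space X Y R s"
  show ?thesis
  proof (rule dGHc_le)
    show "continuous_map (mtopology_of X) (mtopology_of ?S) (\<lambda>x. (x, f x))"
      by (rule continuous_map_into_interp_space[OF R s]) (use f in \<open>auto simp: R_def corr_def\<close>)
    show "continuous_map (mtopology_of ?S) (mtopology_of X) fst"
      by (rule continuous_map_interp_space_fst[OF R s])
    show "distortion X ?S (corr X ?S (\<lambda>x. (x, f x)) fst) \<le> ennreal s * distortion X Y R"
    proof (rule distortion_le_scaled[where u = fst and v = id])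
      fix x y x' y'
      have "mdist X x x' - mdist ?S (x, y) (x', y') = s * (mdist X x x' - mdist Y y y')"
        by (simp add: interp_space_simps(2)[OF R s] algebra_simps)
      then show "\<bar>mdist X (fst (x, y)) (fst (x', y')) - mdist ?S (id (x, y)) (id (x', y'))\<bar>
          = s * \<bar>mdist X x x' - mdist Y y y'\<bar>"
        using s by (simp add: abs_mult)
    \<comment> \<open>The outer correspondence is unfolded first, with \<open>R\<close> still
      folded, so that the carrier of \<open>?S\<close> simplifies to \<open>R\<close>; only then is
      membership of \<open>(x, f x)\<close> in \<open>R\<close> resolved.\<close>
    qed (use s in \<open>auto simp: corr_def[of X ?S] interp_space_simps[OF R s]\<close>,
        auto simp: R_def corr_def)
  qed
qed

lemma dGHc_interp_space_right:
  assumes s: "0 < s" "s < 1"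
  shows "dGHc (interp_space X Y R s) Y \<le> ennreal (1 - s) * distortion X Y R / 2"
proof -
  note R = corr_subset[OF f g, folded R_def]
  let ?S = "interp_space X Y R s"
  show ?thesis
  proof (rule dGHc_le)
    show "continuous_map (mtopology_of Y) (mtopology_of ?S) (\<lambda>y. (g y, y))"
      by (rule continuous_map_into_interp_space[OF R s]) (use g in \<open>auto simp: R_def corr_def\<close>)
    show "continuous_map (mtopology_of ?S) (mtopology_of Y) snd"
      by (rule continuous_map_interp_space_snd[OF R s])
    show "distortion ?S Y (corr ?S Y snd (\<lambda>y. (g y, y))) \<le> ennreal (1 - s) * distortion X Y R"
    proof (rule distortion_le_scaled[where u = id and v = snd])
      fix x y x' y'
      have "mdist ?S (x, y) (x', y') - mdist Y y y' = (1 - s) * (mdist X x x' - mdist Y y y')"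
        by (simp add: interp_space_simps(2)[OF R s] algebra_simps)
      then show "\<bar>mdist ?S (id (x, y)) (id (x', y')) - mdist Y (snd (x, y)) (snd (x', y'))\<bar>
          = (1 - s) * \<bar>mdist X x x' - mdist Y y y'\<bar>"
        using s by (simp add: abs_mult)
    qed (use s in \<open>auto simp: corr_def[of ?S Y] interp_space_simps[OF R s]\<close>,
        auto simp: R_def corr_def)
  qed
qed

text \<open>Both maps are the identity on \<open>R\<close>. It is continuous from parameter
  \<open>t\<close> to \<open>s\<close> and back because both projections are continuous for either
  metric.\<close>

lemma dGHc_interp_space_interp_space:
  assumes t: "0 < t" "t < 1" and s: "0 < s" "s < 1"
  shows "dGHc (interp_space X Y R t) (interp_space X Y R s) \<le> ennreal \<bar>t - s\<bar> * distortion X Y R / 2"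
proof -
  note R = corr_subset[OF f g, folded R_def]
  let ?S = "interp_space X Y R"
  have id: "continuous_map (mtopology_of (?S t)) (mtopology_of (?S s)) id"
    if t: "0 < t" "t < 1" and s: "0 < s" "s < 1" for t s
    by (rule continuous_map_into_interp_space[OF R s])
      (auto simp: interp_space_simps[OF R t] continuous_map_interp_space_fst[OF R t]
        continuous_map_interp_space_snd[OF R t])
  show ?thesis
  proof (rule dGHc_le[OF id[OF t s] id[OF s t]])
    show "distortion (?S t) (?S s) (corr (?S t) (?S s) id id) \<le> ennreal \<bar>t - s\<bar> * distortion X Y R"
    proof (rule distortion_le_scaled[where u = id and v = id])
      fix x y x' y'
      have "mdist (?S t) (x, y) (x', y') - mdist (?S s) (x, y) (x', y')
          = (s - t) * (mdist X x x' - mdist Y y y')"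
        by (simp add: interp_space_simps(2)[OF R s] interp_space_simps(2)[OF R t] algebra_simps)
      then show "\<bar>mdist (?S t) (id (x, y)) (id (x', y')) - mdist (?S s) (id (x, y)) (id (x', y'))\<bar>
          = \<bar>t - s\<bar> * \<bar>mdist X x x' - mdist Y y y'\<bar>"
        by (simp add: abs_mult abs_minus_commute)
    qed (auto simp: corr_def[of "?S t"] interp_space_simps[OF R s] interp_space_simps[OF R t])
  qed
qed

text \<open>The spaces \<open>\<gamma> t\<close> need not be the \<open>R\<^sub>t\<close> themselves, so that the estimate applies to isometric
  copies in any type.\<close>

lemma dGHc_interpolation:
  fixes \<gamma> :: "real \<Rightarrow> 'c metric"
  assumes 0: "dGHc (\<gamma> 0) X = 0" and 1: "dGHc (\<gamma> 1) Y = 0"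
    and between: "\<And>t. 0 < t \<Longrightarrow> t < 1 \<Longrightarrow> dGHc (\<gamma> t) (interp_space X Y R t) = 0"
    and "t \<in> {0..1}" "s \<in> {0..1}"
  shows "dGHc (\<gamma> t) (\<gamma> s) \<le> ennreal \<bar>t - s\<bar> * (distortion X Y R / 2)"
  using \<open>t \<in> {0..1}\<close> \<open>s \<in> {0..1}\<close>
proof (induction t s rule: linorder_wlog)
  case (sym t s)
  then show ?case by (simp add: dGHc_commute[of "\<gamma> s"] abs_minus_commute[of s])
next
  case (le t s)
  \<comment> \<open>Endpoints are separated from interior parameters, since there \<open>R\<close>
    parametrises the space by a projection instead of the identity.\<close>
  consider "t = s" | "t = 0" "s = 1" | "t = 0" "0 < s" "s < 1" | "0 < t" "t < 1" "s = 1"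
    | "0 < t" "t < 1" "0 < s" "s < 1"
    using le by (auto simp: le_less)
  then show ?case
  proof cases
    case 1
    then show ?thesis by simp
  next
    case 2
    \<comment> \<open>The parameters differ by exactly 1, and \<open>f\<close>, \<open>g\<close>
      themselves give the bound.\<close>
    have "dGHc X Y \<le> distortion X Y R / 2"
      using f g by (auto intro: dGHc_le simp: R_def)
    then show ?thesis
      using 2 dGHc_cong_le[OF assms(1,2)] by simp
  next
    case 3
    then show ?thesis
      using order.trans[OF dGHc_cong_le[OF 0 between] dGHc_left_interp_space[of s]]
      by (simp add: ennreal_times_divide)
  next
    case 4
    then show ?thesis
      using order.trans[OF dGHc_cong_le[OF between 1] dGHc_interp_space_right[of t]]
      by (simp add: ennreal_times_divide)
  next
    case 5
    then show ?thesis
      using order.trans[OF dGHc_cong_le[OF between between] dGHc_interp_space_interp_space[of t s]]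
      by (simp add: ennreal_times_divide)
  qed
qed

end

subsection \<open>Length\<close>

text \<open>The Lipschitz bounds over a partition telescope to
  \<open>\<tau> n - \<tau> 0 = 1\<close> times \<open>c\<close>.\<close>

lemma curve_length_le:
  assumes "\<And>t s. t \<in> {0..1} \<Longrightarrow> s \<in> {0..1} \<Longrightarrow> d (\<gamma> t) (\<gamma> s) \<le> ennreal \<bar>t - s\<bar> * c"
  shows "curve_length d \<gamma> \<le> c"
  unfolding curve_length_def
proof (rule SUP_least, clarify)
  fix n and \<tau> :: "nat \<Rightarrow> real"
  assume \<tau>: "\<tau> 0 = 0" "\<tau> n = 1" "\<forall>i<n. \<tau> i < \<tau> (Suc i)"
  have mono: "\<tau> i \<le> \<tau> j" if "i \<le> j" "j \<le> n" for i j
    using that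
  proof (induction j rule: dec_induct)
    case (step m)
    then have "\<tau> i \<le> \<tau> m" "\<tau> m < \<tau> (Suc m)"
      using \<tau>(3) by auto
    then show ?case by linarith
  qed simp
  have mem: "\<tau> i \<in> {0..1}" if "i \<le> n" for i
    using mono[of 0 i] mono[of i n] that \<tau> by auto
  have "(\<Sum>i<n. d (\<gamma> (\<tau> i)) (\<gamma> (\<tau> (Suc i)))) \<le> (\<Sum>i<n. ennreal (\<tau> (Suc i) - \<tau> i) * c)"
  proof (rule sum_mono)
    fix i assume "i \<in> {..<n}"
    then show "d (\<gamma> (\<tau> i)) (\<gamma> (\<tau> (Suc i))) \<le> ennreal (\<tau> (Suc i) - \<tau> i) * c"
      using assms[OF mem[of i] mem[of "Suc i"]] \<tau>(3) by auto
  qed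
  also have "\<dots> = ennreal (\<Sum>i<n. \<tau> (Suc i) - \<tau> i) * c"
    using \<tau>(3) by (subst sum_ennreal[symmetric]) (auto simp: sum_distrib_right less_imp_le)
  also have "\<dots> = c"
    using \<tau> by (simp add: sum_lessThan_telescope)
  finally show "(\<Sum>i<n. d (\<gamma> (\<tau> i)) (\<gamma> (\<tau> (Suc i)))) \<le> c" .
qed

lemma dist_le_curve_length: "d (\<gamma> 0) (\<gamma> 1) \<le> curve_length d \<gamma>"
  unfolding curve_length_def
  \<comment> \<open>The partition with a single step from 0 to 1.\<close>
  by (rule SUP_upper2[of "(1, real)"]) auto

lemma curve_in_Lipschitz:
  assumes "\<And>t. t \<in> {0..1} \<Longrightarrow> \<gamma> t \<in> M"
    and bound: "\<And>t s. t \<in> {0..1} \<Longrightarrow> s \<in> {0..1} \<Longrightarrow> d (\<gamma> t) (\<gamma> s) \<le> ennreal \<bar>t - s\<bar> * c"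
    and "c < \<infinity>"
  shows "curve_in M d \<gamma>"
  unfolding curve_in_def
proof (intro conjI ballI)
  fix t :: real assume t: "t \<in> {0..1}"
  \<comment> \<open>Finiteness of \<open>c\<close> reduces the limit to one of real numbers; the
    distance is then squeezed between 0 and this bound.\<close>
  obtain r where r: "0 \<le> r" "c = ennreal r"
    using \<open>c < \<infinity>\<close> by (cases c) auto
  have "((\<lambda>s. ennreal (\<bar>t - s\<bar> * r)) \<longlongrightarrow> ennreal (\<bar>t - t\<bar> * r)) (at t within {0..1})"
    by (intro tendsto_intros)
  then have "((\<lambda>s. ennreal (\<bar>t - s\<bar> * r)) \<longlongrightarrow> 0) (at t within {0..1})"
    by simp
  then show "((\<lambda>s. d (\<gamma> t) (\<gamma> s)) \<longlongrightarrow> 0) (at t within {0..1})"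
    by (rule tendsto_sandwich[OF _ _ tendsto_const, rotated 2])
      (use bound[OF t] r in \<open>auto simp: eventually_at_filter ennreal_mult\<close>)
qed (use assms in auto)

section \<open>Intrinsicness within an infinite type\<close>

lemma inj_prod_infinite:
  includes cardinal_syntax
  shows "\<exists>e :: 'u::infinite \<times> 'u \<Rightarrow> 'u. inj e"
proof -
  \<comment> \<open>An infinite cardinal equals its own square.\<close>
  have "|UNIV \<times> UNIV :: ('u \<times> 'u) set| =o |UNIV :: 'u set|"
    by (rule card_of_Times_same_infinite) (rule infinite_UNIV)
  then show ?thesis
    by (metis UNIV_Times_UNIV bij_betw_imp_inj_on card_of_ordIso)
qed

lemma gen_pseudometric_on_dGHc: "gen_pseudometric_on M dGHc"
  unfolding gen_pseudometric_on_def
  by (intro conjI ballI dGHc_refl dGHc_commute dGHc_triangle)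

lemma corr_nonempty: "mspace X \<noteq> {} \<Longrightarrow> corr X Y f g \<noteq> {}"
  by (auto simp: corr_def)

text \<open>Each pair \<open>f\<close>, \<open>g\<close> with finite distortion yields a curve from
  \<open>X\<close> to \<open>Y\<close> of length at most half that distortion. Taking the infimum
  over all pairs bounds the infimum of lengths by the distance, with no \<epsilon> to be chosen; the
  one-step partition gives the converse.\<close>

lemma intrinsic_on_dGHc: "intrinsic_on (metric_spaces :: 'u::infinite metric set) dGHc"
  unfolding intrinsic_on_def
proof (intro conjI ballI impI gen_pseudometric_on_dGHc antisym)
  fix X Y :: "'u metric"
  assume XY: "X \<in> metric_spaces" "Y \<in> metric_spaces"
  let ?C = "{\<gamma>. curve_in metric_spaces dGHc \<gamma> \<and> \<gamma> 0 = X \<and> \<gamma> 1 = Y}"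
  show "dGHc X Y \<le> (INF \<gamma>\<in>?C. curve_length dGHc \<gamma>)"
    by (rule INF_greatest) (use dist_le_curve_length in auto)
  show "(INF \<gamma>\<in>?C. curve_length dGHc \<gamma>) \<le> dGHc X Y"
  proof (rule dGHc_greatest)
    fix f g
    assume f: "continuous_map (mtopology_of X) (mtopology_of Y) f"
      and g: "continuous_map (mtopology_of Y) (mtopology_of X) g"
    define R where "R = corr X Y f g"
    note R = corr_subset[OF f g, folded R_def]
    obtain e :: "'u \<times> 'u \<Rightarrow> 'u" where e: "inj e"
      using inj_prod_infinite by blast
    \<comment> \<open>The endpoints stay \<open>X\<close> and \<open>Y\<close> themselves, as the
      curve must join exactly these; only the interior spaces need to be copied into
      \<open>'u\<close>.\<close>
    define \<gamma> where "\<gamma> t = (if t = 0 then X else if t = 1 then Y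
      else isometric_copy e (interp_space X Y R t))" for t
    have bound: "dGHc (\<gamma> t) (\<gamma> s) \<le> ennreal \<bar>t - s\<bar> * (distortion X Y R / 2)"
      if "t \<in> {0..1}" "s \<in> {0..1}" for t s
      unfolding R_def using that
      by (intro dGHc_interpolation[OF f g])
        (auto simp: \<gamma>_def R_def intro!: dGHc_isometric_copy intro: inj_on_subset[OF e])
    show "(INF \<gamma>\<in>?C. curve_length dGHc \<gamma>) \<le> distortion X Y (corr X Y f g) / 2"
    \<comment> \<open>An infinite bound holds trivially; a finite one makes the Lipschitz estimate
      imply continuity of the curve.\<close>
    proof (cases "distortion X Y R / 2 = \<infinity>")
      case True
      then show ?thesis by (simp add: R_def)
    next
      case False
      have "\<gamma> t \<in> metric_spaces" if "t \<in> {0..1}" for t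
      proof (cases "t = 0 \<or> t = 1")
        case False
        then have "mspace (interp_space X Y R t) = R"
          using that by (intro interp_space_simps(1)[OF R]) auto
        then show ?thesis
          using False XY corr_nonempty[of X Y f g] isometric_copy_simps(1)[OF inj_on_subset[OF e]]
          by (simp add: \<gamma>_def metric_spaces_def R_def)
      qed (use XY in \<open>auto simp: \<gamma>_def\<close>)
      then have "curve_in metric_spaces dGHc \<gamma>"
        using False bound by (intro curve_in_Lipschitz) (auto simp: less_top)
      then have "\<gamma> \<in> ?C"
        by (simp add: \<gamma>_def)
      then show ?thesis
        unfolding R_def[symmetric] by (rule INF_lower2) (intro curve_length_le bound)
    qed
  qed
qed

section \<open>The interpolating curve in the disjoint sum\<close>

lemma dGHc_interp_curve:
  fixes X :: "'a metric" and Y :: "'b metric"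
  assumes "continuous_map (mtopology_of X) (mtopology_of Y) f"
    and "continuous_map (mtopology_of Y) (mtopology_of X) g"
    and "t \<in> {0..1}" "s \<in> {0..1}"
  shows "dGHc (interp_curve X Y (corr X Y f g) t) (interp_curve X Y (corr X Y f g) s)
    \<le> ennreal \<bar>t - s\<bar> * (distortion X Y (corr X Y f g) / 2)"
proof -
  \<comment> \<open>Embedding \<open>X\<close>, \<open>Y\<close> and the interior spaces into the
    sum type changes each of them by distance 0 only.\<close>
  have 0: "dGHc (interp_curve X Y (corr X Y f g) 0) X = 0"
    unfolding interp_curve_def if_P[OF refl] by (rule dGHc_isometric_copy) (rule inj_Inl)
  have "inj_on (Inr \<circ> Inl :: 'b \<Rightarrow> 'a + 'b + 'a \<times> 'b) (mspace Y)"
    by (simp add: inj_on_def)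
  then have 1: "dGHc (interp_curve X Y (corr X Y f g) 1) Y = 0"
    by (simp add: interp_curve_def dGHc_isometric_copy)
  have between: "dGHc (interp_curve X Y (corr X Y f g) t) (interp_space X Y (corr X Y f g) t) = 0"
    if "0 < t" "t < 1" for t
  proof -
    have "inj_on (Inr \<circ> Inr :: 'a \<times> 'b \<Rightarrow> 'a + 'b + 'a \<times> 'b) S" for S
      by (simp add: inj_on_def)
    then have "dGHc (isometric_copy (Inr \<circ> Inr :: 'a \<times> 'b \<Rightarrow> 'a + 'b + 'a \<times> 'b) S) S = 0" for S
      by (rule dGHc_isometric_copy)
    then show ?thesis
      using that by (simp add: interp_curve_def)
  qed
  show ?thesis
    using dGHc_interpolation[where \<gamma> = "interp_curve X Y (corr X Y f g)", OF assms(1,2) 0 1 between assms(3,4)]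
    by blast
qed

lemma interp_curve_in_metric_spaces:
  assumes R: "R \<subseteq> mspace X \<times> mspace Y" "R \<noteq> {}" and t: "t \<in> {0..1}"
  shows "interp_curve X Y R t \<in> metric_spaces"
proof -
  have "mspace (interp_space X Y R t) = R" if "t \<noteq> 0" "t \<noteq> 1"
    using that t by (intro interp_space_simps(1)[OF R(1)]) auto
  then show ?thesis
    using R by (auto simp: interp_curve_def metric_spaces_def isometric_copy_simps inj_on_def)
qed

theorem theorem9p1:
  shows "(\<forall>(X::'a metric) (Y::'b metric) (\<epsilon>::real) f g.
           mspace X \<noteq> {} \<longrightarrow> mspace Y \<noteq> {} \<longrightarrow>
           dGHc X Y < \<infinity> \<longrightarrow> 0 < \<epsilon> \<longrightarrow>
           continuous_map (mtopology_of X) (mtopology_of Y) f \<longrightarrow>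
           continuous_map (mtopology_of Y) (mtopology_of X) g \<longrightarrow>
           distortion X Y (corr X Y f g) < 2 * dGHc X Y + 2 * ennreal \<epsilon> \<longrightarrow>
           (let R = corr X Y f g; \<gamma> = interp_curve X Y R in
             (\<forall>t\<in>{0..1}. \<forall>s\<in>{0..1}. dGHc (\<gamma> t) (\<gamma> s) \<le> ennreal \<bar>t - s\<bar> * distortion X Y R) \<and>
             curve_in metric_spaces dGHc \<gamma> \<and>
             curve_length dGHc \<gamma> < dGHc X Y + ennreal \<epsilon>)) \<and>
         intrinsic_on (metric_spaces :: 'u::infinite metric set) dGHc"
proof (intro conjI allI impI)
  fix X :: "'a metric" and Y :: "'b metric" and \<epsilon> :: real and f g
  assume ne: "mspace X \<noteq> {}" "mspace Y \<noteq> {}" and fin: "dGHc X Y < \<infinity>" and \<epsilon>: "0 < \<epsilon>"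
    and f: "continuous_map (mtopology_of X) (mtopology_of Y) f"
    and g: "continuous_map (mtopology_of Y) (mtopology_of X) g"
    and dis: "distortion X Y (corr X Y f g) < 2 * dGHc X Y + 2 * ennreal \<epsilon>"
  define R where "R = corr X Y f g"
  define D where "D = distortion X Y R"
  note R = corr_subset[OF f g, folded R_def]
  note bound = dGHc_interp_curve[OF f g, folded R_def, folded D_def]
  have D: "D = 2 * (D / 2)"
    by (simp add: ennreal_times_divide mult_divide_eq_ennreal mult.commute)
  \<comment> \<open>The assumption on the distortion is halved; by contradiction, this needs only
    that doubling preserves \<open>\<le>\<close>.\<close>
  have half: "D / 2 < dGHc X Y + ennreal \<epsilon>"
  proof (rule ccontr)
    assume "\<not> ?thesis"
    then have "2 * (dGHc X Y + ennreal \<epsilon>) \<le> 2 * (D / 2)"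
      by (intro mult_left_mono) auto
    then show False
      using dis by (simp add: distrib_left leD D_def[symmetric] R_def[symmetric] flip: D)
  qed
  \<comment> \<open>The Lipschitz constant obtained is \<open>D / 2\<close>; the estimate claimed
    with \<open>D\<close> is weaker.\<close>
  have "D / 2 \<le> D"
    by (subst (2) D) (simp add: mult_2)
  then have "dGHc (interp_curve X Y R t) (interp_curve X Y R s) \<le> ennreal \<bar>t - s\<bar> * D"
    if "t \<in> {0..1}" "s \<in> {0..1}" for t s
    using bound[OF that] by (meson mult_left_mono order.trans zero_le)
  moreover have "curve_in metric_spaces dGHc (interp_curve X Y R)"
  proof (rule curve_in_Lipschitz[where c = "D / 2"])
    show "D / 2 < \<infinity>"
      using half by (auto simp: less_top[symmetric])
  qed (use interp_curve_in_metric_spaces[OF R] corr_nonempty[OF ne(1), of Y f g] bound in \<open>auto simp: R_def\<close>)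
  \<comment> \<open>Here the sharper constant matters: \<open>half\<close> bounds
    \<open>D / 2\<close>, and hence the length, strictly.\<close>
  moreover have "curve_length dGHc (interp_curve X Y R) < dGHc X Y + ennreal \<epsilon>"
    using half by (rule order.strict_trans1[OF curve_length_le, rotated]) (rule bound)
  ultimately show "let R = corr X Y f g; \<gamma> = interp_curve X Y R in
             (\<forall>t\<in>{0..1}. \<forall>s\<in>{0..1}. dGHc (\<gamma> t) (\<gamma> s) \<le> ennreal \<bar>t - s\<bar> * distortion X Y R) \<and>
             curve_in metric_spaces dGHc \<gamma> \<and>
             curve_length dGHc \<gamma> < dGHc X Y + ennreal \<epsilon>"
    unfolding Let_def R_def[symmetric] D_def[symmetric] by blast
qed (rule intrinsic_on_dGHc)

end
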